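(* Let $\mathbb{K}$ be a field of characteristic $0$ and $\mathcal{H}$ the $\mathbb{K}$-vector space freely spanned by totally assigned graphs (TAGs). Let $\Delta:\mathcal{H}\to\mathcal{H}\otimes\mathcal{H}$ be defined linearly by $\Delta\big((\Gamma,\mu)\big)=\sum_{\emptyset\subseteq(\gamma,\nu)\subseteq(\Gamma,\mu)}(\gamma,\nu)\otimes(\Gamma/\gamma,\mu/\nu)$ (sum over all totally assigned subgraphs), and let $\epsilon:\mathcal{H}\to\mathbb{K}$ be defined linearly by $\epsilon\big((\Gamma,\mu)\big)=1$ if $(\Gamma,\mu)=1_{\mathcal{H}}$ and $0$ otherwise. Then $(\mathcal{H},\Delta,\epsilon)$ is a coassociative coalgebra with counit.
   Context: Graphs are finite, possibly disconnected, with loops and multiple edges allowed; $E(\Gamma)$ is the edge set. A TAG is a pair $(\Gamma,\mu)$ where $\mu$ is a total order on $E(\Gamma)$; $1_{\mathcal{H}}$ is the empty graph. A subgraph $\gamma$ of $\Gamma$ is the graph formed by a subset of $E(\Gamma)$ together with the vertices these edges are incident to in $\Gamma$. A totally assigned subgraph $(\gamma,\nu)$ of $(\Gamma,\mu)$ is a subgraph with $\nu$ the restriction of $\mu$ to $E(\gamma)$. The shrinking $(\Gamma/\gamma,\mu/\nu)$: $\Gamma/\gamma$ is obtained by contracting each connected component of $\gamma$ to a point, and $\mu/\nu$ is the restriction of $\mu$ to the edges of $\Gamma$ not in $\gamma$.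
   Formalization: TAGs are taken up to isomorphism and isolated vertices are disregarded, so every edgeless graph equals the empty graph; otherwise, for a single edge, the shrinking of the graph by itself is a point, not the empty graph, and the right counit law fails. *)

theory Defs
  imports Complex_Main "HOL-Library.Poly_Mapping"
begin

section \<open>Free vector spaces and their tensor products\<close>

text \<open>
  The vector space freely spanned by a type \<open>'b\<close> over a field \<open>'k\<close> is the type of finitely
  supported functions \<open>'b \<Rightarrow>\<^sub>0 'k\<close>.
\<close>

definition fscale :: "'k \<Rightarrow> ('b \<Rightarrow>\<^sub>0 'k) \<Rightarrow> ('b \<Rightarrow>\<^sub>0 'k::field)" (infixr \<open>\<cdot>\<close> 75)
  where "c \<cdot> x = Poly_Mapping.map ((*) c) x"

abbreviation basis_vec :: "'b \<Rightarrow> ('b \<Rightarrow>\<^sub>0 'k::field)"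
  where "basis_vec b \<equiv> Poly_Mapping.single b 1"

definition lin_ext :: "('k \<Rightarrow> 'c \<Rightarrow> 'c) \<Rightarrow> ('b \<Rightarrow> 'c) \<Rightarrow> ('b \<Rightarrow>\<^sub>0 'k::field) \<Rightarrow> 'c::ab_group_add"
  where "lin_ext s f x = (\<Sum>b\<in>Poly_Mapping.keys x. s (Poly_Mapping.lookup x b) (f b))"

text \<open>
  The tensor product of the spaces spanned by \<open>'a\<close> and \<open>'b\<close> is modelled as the space spanned by
  \<open>'a \<times> 'b\<close>; the universal property is proved below (\<open>tensor_universal\<close>).
\<close>

definition tensor :: "('a \<Rightarrow>\<^sub>0 'k) \<Rightarrow> ('b \<Rightarrow>\<^sub>0 'k) \<Rightarrow> ('a \<times> 'b \<Rightarrow>\<^sub>0 'k::field)" (infixr \<open>\<otimes>\<close> 70)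
  where "x \<otimes> y = lin_ext (\<cdot>) (\<lambda>a. lin_ext (\<cdot>) (\<lambda>b. basis_vec (a, b)) y) x"

definition tensor_lift ::
    "('k \<Rightarrow> 'c \<Rightarrow> 'c) \<Rightarrow> (('a \<Rightarrow>\<^sub>0 'k) \<Rightarrow> ('b \<Rightarrow>\<^sub>0 'k) \<Rightarrow> 'c) \<Rightarrow>
     ('a \<times> 'b \<Rightarrow>\<^sub>0 'k::field) \<Rightarrow> 'c::ab_group_add"
  where "tensor_lift s \<beta> = lin_ext s (\<lambda>(a, b). \<beta> (basis_vec a) (basis_vec b))"

definition tensor_map ::
    "(('a \<Rightarrow>\<^sub>0 'k) \<Rightarrow> ('c \<Rightarrow>\<^sub>0 'k)) \<Rightarrow> (('b \<Rightarrow>\<^sub>0 'k) \<Rightarrow> ('d \<Rightarrow>\<^sub>0 'k)) \<Rightarrow>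
     ('a \<times> 'b \<Rightarrow>\<^sub>0 'k) \<Rightarrow> ('c \<times> 'd \<Rightarrow>\<^sub>0 'k::field)"
  where "tensor_map f g = tensor_lift (\<cdot>) (\<lambda>x y. f x \<otimes> g y)"

text \<open>The canonical map \<open>(x \<otimes> y) \<otimes> z \<mapsto> x \<otimes> (y \<otimes> z)\<close>.\<close>

definition tensor_assoc :: "(('a \<times> 'b) \<times> 'c \<Rightarrow>\<^sub>0 'k) \<Rightarrow> ('a \<times> 'b \<times> 'c \<Rightarrow>\<^sub>0 'k::field)"
  where "tensor_assoc = tensor_lift (\<cdot>) (\<lambda>u z. tensor_lift (\<cdot>) (\<lambda>x y. x \<otimes> (y \<otimes> z)) u)"

text \<open>
  In the counit laws, \<open>tensor_lift (\<cdot>) (\<lambda>x y. \<epsilon> x \<cdot> y)\<close> is \<open>\<epsilon> \<otimes> id\<close> followed by the canonical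
  isomorphism from the tensor product of the ground field and the space to the space itself.
\<close>

locale coalgebra =
  fixes \<Delta> :: "('b \<Rightarrow>\<^sub>0 'k::field) \<Rightarrow> ('b \<times> 'b \<Rightarrow>\<^sub>0 'k)"
    and \<epsilon> :: "('b \<Rightarrow>\<^sub>0 'k) \<Rightarrow> 'k"
  assumes linear_comult: "Vector_Spaces.linear (\<cdot>) (\<cdot>) \<Delta>"
    and linear_counit: "Vector_Spaces.linear (\<cdot>) (*) \<epsilon>"
    and coassoc: "tensor_assoc (tensor_map \<Delta> id (\<Delta> x)) = tensor_map id \<Delta> (\<Delta> x)"
    and counit_left: "tensor_lift (\<cdot>) (\<lambda>x y. \<epsilon> x \<cdot> y) (\<Delta> x) = x"
    and counit_right: "tensor_lift (\<cdot>) (\<lambda>x y. \<epsilon> y \<cdot> x) (\<Delta> x) = x"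

lemma lookup_fscale [simp]: "Poly_Mapping.lookup (c \<cdot> x) b = c * Poly_Mapping.lookup x b"
  by (simp add: fscale_def Poly_Mapping.map.rep_eq when_def)

lemma vector_space_fscale: "vector_space (\<cdot>)"
  by (unfold_locales) (auto intro!: poly_mapping_eqI simp: lookup_add algebra_simps)

lemma vector_space_field: "vector_space ((*) :: 'k::field \<Rightarrow> 'k \<Rightarrow> 'k)"
  by (unfold_locales) (auto simp: algebra_simps)

lemma lin_ext_superset:
  assumes "vector_space s" "finite A" "Poly_Mapping.keys x \<subseteq> A"
  shows "lin_ext s f x = (\<Sum>b\<in>A. s (Poly_Mapping.lookup x b) (f b))"
proof -
  interpret vector_space s by fact
  show ?thesis
    unfolding lin_ext_def
    by (rule sum.mono_neutral_left) (use assms in \<open>auto simp: in_keys_iff\<close>)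
qed

lemma linear_lin_ext:
  assumes "vector_space s"
  shows "Vector_Spaces.linear (\<cdot>) s (lin_ext s f)"
proof -
  interpret V: vector_space s by fact
  interpret F: vector_space "(\<cdot>) :: 'a \<Rightarrow> ('c \<Rightarrow>\<^sub>0 'a) \<Rightarrow> _" by (rule vector_space_fscale)
  show ?thesis
  proof
    fix x y :: "'c \<Rightarrow>\<^sub>0 'a" and c :: 'a
    define A where "A = Poly_Mapping.keys x \<union> Poly_Mapping.keys y \<union> Poly_Mapping.keys (x + y) \<union>
      Poly_Mapping.keys (c \<cdot> x)"
    have A: "finite A" "Poly_Mapping.keys x \<subseteq> A" "Poly_Mapping.keys y \<subseteq> A"
        "Poly_Mapping.keys (x + y) \<subseteq> A" "Poly_Mapping.keys (c \<cdot> x) \<subseteq> A"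
      by (auto simp: A_def)
    note ext = lin_ext_superset[OF assms A(1), of _ f]
    show "lin_ext s f (x + y) = lin_ext s f x + lin_ext s f y"
      unfolding ext[OF A(2)] ext[OF A(3)] ext[OF A(4)]
      by (simp add: lookup_add V.scale_left_distrib sum.distrib)
    show "lin_ext s f (c \<cdot> x) = s c (lin_ext s f x)"
      unfolding ext[OF A(2)] ext[OF A(5)] by (simp add: V.scale_sum_right)
  qed
qed

lemma lin_ext_basis_vec [simp]:
  assumes "vector_space s"
  shows "lin_ext s f (basis_vec b) = f b"
proof -
  interpret V: vector_space s by fact
  show ?thesis by (simp add: lin_ext_def)
qed

lemma lin_ext_self: "lin_ext (\<cdot>) basis_vec x = x"
  by (rule poly_mapping_eqI)
    (auto simp: lin_ext_def lookup_sum lookup_single when_def in_keys_iff if_distrib cong: if_cong)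

lemma linear_eq_lin_ext:
  assumes "Vector_Spaces.linear (\<cdot>) s \<phi>"
  shows "\<phi> x = lin_ext s (\<lambda>b. \<phi> (basis_vec b)) x"
proof -
  interpret L: Vector_Spaces.linear "(\<cdot>)" s \<phi> by fact
  have "\<phi> x = \<phi> (lin_ext (\<cdot>) basis_vec x)" by (simp add: lin_ext_self)
  also have "\<dots> = lin_ext s (\<lambda>b. \<phi> (basis_vec b)) x"
    by (simp add: lin_ext_def L.sum L.scale)
  finally show ?thesis .
qed

lemma tensor_basis_vec [simp]: "basis_vec a \<otimes> basis_vec b = basis_vec (a, b)"
  by (simp add: tensor_def vector_space_fscale)

lemma linear_tensor_right: "Vector_Spaces.linear (\<cdot>) (\<cdot>) (\<lambda>y. x \<otimes> y)"
proof -
  interpret V: vector_space "(\<cdot>) :: 'a \<Rightarrow> ('c \<times> 'b \<Rightarrow>\<^sub>0 'a) \<Rightarrow> _" by (rule vector_space_fscale)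
  interpret W: vector_space "(\<cdot>) :: 'a \<Rightarrow> ('b \<Rightarrow>\<^sub>0 'a) \<Rightarrow> _" by (rule vector_space_fscale)
  have l: "Vector_Spaces.linear (\<cdot>) (\<cdot>) (lin_ext (\<cdot>) (\<lambda>b. basis_vec (a, b)) :: ('b \<Rightarrow>\<^sub>0 'a) \<Rightarrow> _)"
    for a :: 'c by (rule linear_lin_ext[OF vector_space_fscale])
  have hom: "module_hom (\<cdot>) (\<cdot>) (lin_ext (\<cdot>) (\<lambda>b. basis_vec (a, b)) :: ('b \<Rightarrow>\<^sub>0 'a) \<Rightarrow> _)"
    for a :: 'c using l by (simp add: module_hom_iff_linear)
  have sum: "lin_ext (\<cdot>) (\<lambda>a. f a + g a) x = lin_ext (\<cdot>) f x + lin_ext (\<cdot>) g x"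
    for f g :: "'c \<Rightarrow> ('c \<times> 'b \<Rightarrow>\<^sub>0 'a)"
    by (simp add: lin_ext_def V.scale_right_distrib sum.distrib)
  have scale: "lin_ext (\<cdot>) (\<lambda>a. c \<cdot> f a) x = c \<cdot> lin_ext (\<cdot>) f x"
    for c and f :: "'c \<Rightarrow> ('c \<times> 'b \<Rightarrow>\<^sub>0 'a)"
    by (simp add: lin_ext_def V.scale_sum_right mult.commute)
  show ?thesis
    by unfold_locales
      (simp_all add: tensor_def module_hom.add[OF hom] module_hom.scale[OF hom] sum scale)
qed

lemma linear_tensor_left: "Vector_Spaces.linear (\<cdot>) (\<cdot>) (\<lambda>x. x \<otimes> y)"
  unfolding tensor_def by (rule linear_lin_ext[OF vector_space_fscale])

lemma tensor_universal:
  fixes s :: "'k::field \<Rightarrow> 'c \<Rightarrow> 'c::ab_group_add"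
    and \<beta> :: "('a \<Rightarrow>\<^sub>0 'k) \<Rightarrow> ('b \<Rightarrow>\<^sub>0 'k) \<Rightarrow> 'c"
  assumes left: "\<And>y. Vector_Spaces.linear (\<cdot>) s (\<lambda>x. \<beta> x y)"
    and right: "\<And>x. Vector_Spaces.linear (\<cdot>) s (\<beta> x)"
  shows "Vector_Spaces.linear (\<cdot>) s (tensor_lift s \<beta>)"
    and "tensor_lift s \<beta> (x \<otimes> y) = \<beta> x y"
    and "\<exists>!\<phi>. Vector_Spaces.linear (\<cdot>) s \<phi> \<and> (\<forall>x y. \<phi> (x \<otimes> y) = \<beta> x y)"
proof -
  have vs: "vector_space s" using left by (simp add: Vector_Spaces.linear_def)
  show lin: "Vector_Spaces.linear (\<cdot>) s (tensor_lift s \<beta>)"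
    unfolding tensor_lift_def by (rule linear_lin_ext[OF vs])
  show lift: "tensor_lift s \<beta> (x \<otimes> y) = \<beta> x y" for x y
  proof -
    have comp: "Vector_Spaces.linear (\<cdot>) s (\<lambda>z. tensor_lift s \<beta> (x \<otimes> z))" for x
      using Vector_Spaces.linear_compose[OF linear_tensor_right lin] by (simp add: o_def)
    have comp': "Vector_Spaces.linear (\<cdot>) s (\<lambda>z. tensor_lift s \<beta> (z \<otimes> y))" for y
      using Vector_Spaces.linear_compose[OF linear_tensor_left lin] by (simp add: o_def)
    have *: "tensor_lift s \<beta> (basis_vec a \<otimes> y) = \<beta> (basis_vec a) y" for a y
      by (subst linear_eq_lin_ext[OF comp], subst linear_eq_lin_ext[OF right])
        (simp add: tensor_lift_def vs)
    show ?thesis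
      by (subst linear_eq_lin_ext[OF comp'], subst linear_eq_lin_ext[OF left]) (simp only: *)
  qed
  show "\<exists>!\<phi>. Vector_Spaces.linear (\<cdot>) s \<phi> \<and> (\<forall>x y. \<phi> (x \<otimes> y) = \<beta> x y)"
  proof (rule ex1I[of _ "tensor_lift s \<beta>"])
    show "Vector_Spaces.linear (\<cdot>) s (tensor_lift s \<beta>) \<and>
        (\<forall>x y. tensor_lift s \<beta> (x \<otimes> y) = \<beta> x y)" using lin lift by blast
    fix \<phi> :: "('a \<times> 'b \<Rightarrow>\<^sub>0 'k) \<Rightarrow> 'c"
    assume \<phi>: "Vector_Spaces.linear (\<cdot>) s \<phi> \<and> (\<forall>x y. \<phi> (x \<otimes> y) = \<beta> x y)"
    have "\<phi> (basis_vec p) = (case p of (a, b) \<Rightarrow> \<beta> (basis_vec a) (basis_vec b))" for p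
      using \<phi> by (cases p) (metis (mono_tags, lifting) case_prod_conv tensor_basis_vec)
    then have "(\<lambda>p. \<phi> (basis_vec p)) = (\<lambda>(a, b). \<beta> (basis_vec a) (basis_vec b))" by (rule ext)
    moreover have "\<phi> = lin_ext s (\<lambda>p. \<phi> (basis_vec p))"
      by (rule ext, rule linear_eq_lin_ext) (use \<phi> in blast)
    ultimately show "\<phi> = tensor_lift s \<beta>" by (simp only: tensor_lift_def)
  qed
qed

section \<open>Totally assigned graphs\<close>

text \<open>
  Edges are abstract, so multiple edges are allowed; \<open>ends e\<close> is the set of endpoints of \<open>e\<close>,
  a singleton if \<open>e\<close> is a loop. The field \<open>ord\<close> is the (reflexive) total order on the edges.
\<close>

record ('v, 'e) tagraph =
  verts :: "'v set"
  edges :: "'e set"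
  ends :: "'e \<Rightarrow> 'v set"
  ord :: "'e rel"

definition TAG :: "('v, 'e) tagraph \<Rightarrow> bool"
  where "TAG G \<longleftrightarrow> finite (verts G) \<and> finite (edges G) \<and>
    (\<forall>e\<in>edges G. \<exists>u\<in>verts G. \<exists>v\<in>verts G. ends G e = {u, v}) \<and>
    linear_order_on (edges G) (ord G)"

definition empty_tag :: "('v, 'e) tagraph"
  where "empty_tag = \<lparr>verts = {}, edges = {}, ends = \<lambda>_. {}, ord = {}\<rparr>"

definition subgraph :: "('v, 'e) tagraph \<Rightarrow> 'e set \<Rightarrow> ('v, 'e) tagraph"
  where "subgraph G S = \<lparr>verts = \<Union>(ends G ` S), edges = S, ends = ends G, ord = Restr (ord G) S\<rparr>"

text \<open>
  \<open>u\<close> and \<open>v\<close> are connected by edges in \<open>S\<close>. The classes are the connected components of the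
  subgraph with edge set \<open>S\<close>, and the singletons of the vertices outside this subgraph.
\<close>

definition connected_by :: "('v, 'e) tagraph \<Rightarrow> 'e set \<Rightarrow> 'v rel"
  where "connected_by G S = Restr ({(u, v). \<exists>e\<in>S. ends G e = {u, v}}\<^sup>*) (verts G)"

definition shrink :: "('v, 'e) tagraph \<Rightarrow> 'e set \<Rightarrow> ('v set, 'e) tagraph"
  where "shrink G S = \<lparr>verts = verts G // connected_by G S, edges = edges G - S,
    ends = \<lambda>e. (\<lambda>v. connected_by G S `` {v}) ` ends G e, ord = Restr (ord G) (edges G - S)\<rparr>"

definition tag_iso :: "('v, 'e) tagraph \<Rightarrow> ('w, 'f) tagraph \<Rightarrow> bool"
  where "tag_iso G H \<longleftrightarrow> (\<exists>f g. bij_betw f (verts G) (verts H) \<and> bij_betw g (edges G) (edges H) \<and>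
    (\<forall>e\<in>edges G. ends H (g e) = f ` ends G e) \<and>
    (\<forall>e\<in>edges G. \<forall>e'\<in>edges G. (g e, g e') \<in> ord H \<longleftrightarrow> (e, e') \<in> ord G))"

text \<open>
  Graphs are taken up to isomorphism, and a graph is identified with its subgraph on all of its
  edges, that is, isolated vertices are disregarded. The latter is forced by the definitions: every
  graph has to occur among its own subgraphs, and both the right counit law and coassociativity
  need the shrinking of a graph by itself (a set of isolated points, one per connected component)
  to be the empty graph.
\<close>

definition tag_equiv :: "('v, 'e) tagraph \<Rightarrow> ('w, 'f) tagraph \<Rightarrow> bool"
  where "tag_equiv G H \<longleftrightarrow> tag_iso (subgraph G (edges G)) (subgraph H (edges H))"

lemma tag_equivE:
  assumes "tag_equiv G H"
  obtains f g where "bij_betw f (\<Union>(ends G ` edges G)) (\<Union>(ends H ` edges H))"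
    "bij_betw g (edges G) (edges H)" "\<And>e. e \<in> edges G \<Longrightarrow> ends H (g e) = f ` ends G e"
    "\<And>e e'. \<lbrakk>e \<in> edges G; e' \<in> edges G\<rbrakk> \<Longrightarrow> (g e, g e') \<in> ord H \<longleftrightarrow> (e, e') \<in> ord G"
proof -
  obtain f g where f: "bij_betw f (\<Union>(ends G ` edges G)) (\<Union>(ends H ` edges H))"
    and g: "bij_betw g (edges G) (edges H)" and e: "\<And>e. e \<in> edges G \<Longrightarrow> ends H (g e) = f ` ends G e"
    and o: "\<And>e e'. \<lbrakk>e \<in> edges G; e' \<in> edges G\<rbrakk> \<Longrightarrow>
      (g e, g e') \<in> Restr (ord H) (edges H) \<longleftrightarrow> (e, e') \<in> Restr (ord G) (edges G)"
    using assms unfolding tag_equiv_def tag_iso_def by (auto simp: subgraph_def)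
  have "(g e, g e') \<in> ord H \<longleftrightarrow> (e, e') \<in> ord G" if "e \<in> edges G" "e' \<in> edges G" for e e'
    using o[OF that] g that by (auto dest: bij_betwE)
  with f g e show thesis by (rule that)
qed

lemma tag_equivI:
  assumes f: "inj_on f (\<Union>(ends G ` edges G))" and g: "bij_betw g (edges G) (edges H)"
    and e: "\<And>e. e \<in> edges G \<Longrightarrow> ends H (g e) = f ` ends G e"
    and o: "\<And>e e'. \<lbrakk>e \<in> edges G; e' \<in> edges G\<rbrakk> \<Longrightarrow> (g e, g e') \<in> ord H \<longleftrightarrow> (e, e') \<in> ord G"
  shows "tag_equiv G H"
proof -
  have "\<Union>(ends H ` edges H) = f ` \<Union>(ends G ` edges G)"
    using g e by (simp add: bij_betw_def image_UN flip: bij_betw_imp_surj_on[OF g])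
  then have "bij_betw f (\<Union>(ends G ` edges G)) (\<Union>(ends H ` edges H))"
    using f by (simp add: bij_betw_def)
  then show ?thesis
    unfolding tag_equiv_def tag_iso_def using g e o
    by (intro exI[of _ f] exI[of _ g]) (auto simp: subgraph_def dest: bij_betwE)
qed

lemma tag_equiv_refl: "tag_equiv G G"
  by (rule tag_equivI[of id _ id]) auto

lemma tag_equiv_sym:
  assumes "tag_equiv G H"
  shows "tag_equiv H G"
  using assms
proof (rule tag_equivE)
  fix f g
  assume f: "bij_betw f (\<Union>(ends G ` edges G)) (\<Union>(ends H ` edges H))"
    and g: "bij_betw g (edges G) (edges H)"
    and e: "\<And>e. e \<in> edges G \<Longrightarrow> ends H (g e) = f ` ends G e"
    and o: "\<And>e e'. \<lbrakk>e \<in> edges G; e' \<in> edges G\<rbrakk> \<Longrightarrow> (g e, g e') \<in> ord H \<longleftrightarrow> (e, e') \<in> ord G"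
  let ?f = "inv_into (\<Union>(ends G ` edges G)) f" and ?g = "inv_into (edges G) g"
  have gE: "?g e \<in> edges G" "g (?g e) = e" if "e \<in> edges H" for e
    using that g bij_betw_inv_into_right[OF g that] bij_betwE[OF bij_betw_inv_into[OF g]] by auto
  show ?thesis
  proof (rule tag_equivI[of ?f _ ?g])
    show "inj_on ?f (\<Union>(ends H ` edges H))" using bij_betw_inv_into[OF f] by (simp add: bij_betw_def)
    show "bij_betw ?g (edges H) (edges G)" by (rule bij_betw_inv_into[OF g])
    show "ends G (?g e) = ?f ` ends H e" if "e \<in> edges H" for e
    proof -
      have "ends H e = f ` ends G (?g e)" using e[OF gE(1)[OF that]] gE(2)[OF that] by simp
      moreover have "ends G (?g e) \<subseteq> \<Union>(ends G ` edges G)" using gE(1)[OF that] by blast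
      ultimately show ?thesis
        using f by (simp add: bij_betw_def inv_into_image_cancel)
    qed
    show "(?g e, ?g e') \<in> ord G \<longleftrightarrow> (e, e') \<in> ord H" if "e \<in> edges H" "e' \<in> edges H" for e e'
      using o[OF gE(1)[OF that(1)] gE(1)[OF that(2)]] gE(2) that by simp
  qed
qed

lemma tag_equiv_trans:
  assumes "tag_equiv G H" "tag_equiv H K"
  shows "tag_equiv G K"
  using assms(1)
proof (rule tag_equivE)
  fix f g
  assume f: "bij_betw f (\<Union>(ends G ` edges G)) (\<Union>(ends H ` edges H))"
    and g: "bij_betw g (edges G) (edges H)"
    and e: "\<And>e. e \<in> edges G \<Longrightarrow> ends H (g e) = f ` ends G e"
    and o: "\<And>e e'. \<lbrakk>e \<in> edges G; e' \<in> edges G\<rbrakk> \<Longrightarrow> (g e, g e') \<in> ord H \<longleftrightarrow> (e, e') \<in> ord G"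
  from assms(2) show ?thesis
  proof (rule tag_equivE)
    fix f' g'
    assume f': "bij_betw f' (\<Union>(ends H ` edges H)) (\<Union>(ends K ` edges K))"
      and g': "bij_betw g' (edges H) (edges K)"
      and e': "\<And>e. e \<in> edges H \<Longrightarrow> ends K (g' e) = f' ` ends H e"
      and o': "\<And>e e'. \<lbrakk>e \<in> edges H; e' \<in> edges H\<rbrakk> \<Longrightarrow> (g' e, g' e') \<in> ord K \<longleftrightarrow> (e, e') \<in> ord H"
    have gE: "g e \<in> edges H" if "e \<in> edges G" for e using g that by (auto dest: bij_betwE)
    show ?thesis
    proof (rule tag_equivI[of "f' \<circ> f" _ "g' \<circ> g"])
      show "inj_on (f' \<circ> f) (\<Union>(ends G ` edges G))"
        using bij_betw_trans[OF f f'] by (simp add: bij_betw_def)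
      show "bij_betw (g' \<circ> g) (edges G) (edges K)" by (rule bij_betw_trans[OF g g'])
    qed (simp_all add: e e' o o' gE image_comp)
  qed
qed

subsection \<open>Isomorphism classes\<close>

text \<open>
  Every totally assigned graph is isomorphic to one with natural numbers as vertices and edges.
\<close>

definition tag_rel :: "(nat, nat) tagraph \<Rightarrow> (nat, nat) tagraph \<Rightarrow> bool"
  where "tag_rel G H \<longleftrightarrow> TAG G \<and> TAG H \<and> tag_equiv G H"

lemma TAG_empty_tag: "TAG empty_tag"
  by (simp add: TAG_def empty_tag_def)

quotient_type tag = "(nat, nat) tagraph" / partial: tag_rel
proof (rule part_equivpI)
  show "\<exists>G. tag_rel G G"
    using TAG_empty_tag tag_equiv_refl unfolding tag_rel_def by blast
  show "symp tag_rel" by (auto intro!: sympI simp: tag_rel_def tag_equiv_sym)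
  show "transp tag_rel" by (auto intro!: transpI simp: tag_rel_def intro: tag_equiv_trans)
qed

definition tag_class :: "('v, 'e) tagraph \<Rightarrow> tag"
  where "tag_class G = abs_tag (SOME H. TAG H \<and> tag_equiv G H)"

lemma linear_order_on_inj_image:
  assumes "linear_order_on A r" "inj_on h A"
  shows "linear_order_on (h ` A) (map_prod h h ` r)"
proof -
  have r: "r \<subseteq> A \<times> A" "refl_on A r" "trans r" "antisym r" "total_on A r"
    using assms(1) by (auto simp: order_on_defs)
  have img: "\<exists>a b. (a, b) \<in> r \<and> x = h a \<and> y = h b" if "(x, y) \<in> map_prod h h ` r" for x y
    using that by auto
  have "trans (map_prod h h ` r)"
  proof (rule transI)
    fix x y z assume "(x, y) \<in> map_prod h h ` r" "(y, z) \<in> map_prod h h ` r"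
    then obtain a b b' c where *: "(a, b) \<in> r" "x = h a" "y = h b" "(b', c) \<in> r" "y = h b'" "z = h c"
      by (blast dest: img)
    from * have "b = b'" using r(1) assms(2) by (auto dest: inj_onD)
    then show "(x, z) \<in> map_prod h h ` r" using * transD[OF r(3)] by force
  qed
  moreover have "antisym (map_prod h h ` r)"
  proof (rule antisymI)
    fix x y assume "(x, y) \<in> map_prod h h ` r" "(y, x) \<in> map_prod h h ` r"
    then obtain a b b' c where *: "(a, b) \<in> r" "x = h a" "y = h b" "(b', c) \<in> r" "y = h b'" "x = h c"
      by (blast dest: img)
    from * have "b = b'" "a = c" using r(1) assms(2) by (auto dest: inj_onD)
    then show "x = y" using * antisymD[OF r(4)] by blast
  qed
  moreover have "total_on (h ` A) (map_prod h h ` r)"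
    using r(5) unfolding total_on_def by (auto intro: map_prod_imageI) (metis map_prod_imageI)
  ultimately show ?thesis
    using r(1,2) by (auto simp: order_on_defs refl_on_def intro: map_prod_imageI)
qed

lemma ex_nat_TAG:
  fixes G :: "('v, 'e) tagraph"
  assumes "TAG G"
  shows "\<exists>H :: (nat, nat) tagraph. TAG H \<and> tag_equiv G H"
proof -
  have fin: "finite (verts G)" "finite (edges G)"
    and ends: "\<And>e. e \<in> edges G \<Longrightarrow> \<exists>u\<in>verts G. \<exists>v\<in>verts G. ends G e = {u, v}"
    and lin: "linear_order_on (edges G) (ord G)"
    using assms by (auto simp: TAG_def)
  obtain f :: "'v \<Rightarrow> nat" where f: "inj_on f (verts G)" using finite_imp_inj_to_nat_seg fin(1) by metis
  obtain g :: "'e \<Rightarrow> nat" where g: "inj_on g (edges G)" using finite_imp_inj_to_nat_seg fin(2) by metis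
  define H :: "(nat, nat) tagraph" where "H = \<lparr>verts = f ` verts G, edges = g ` edges G,
    ends = \<lambda>n. f ` ends G (inv_into (edges G) g n), ord = map_prod g g ` ord G\<rparr>"
  have "\<exists>u\<in>verts H. \<exists>v\<in>verts H. ends H n = {u, v}" if n: "n \<in> edges H" for n
  proof -
    obtain e where e: "e \<in> edges G" "n = g e" using n by (auto simp: H_def)
    then obtain u v where "u \<in> verts G" "v \<in> verts G" "ends G e = {u, v}" using ends by blast
    then have "f u \<in> verts H \<and> f v \<in> verts H \<and> ends H n = {f u, f v}"
      using e g by (simp add: H_def)
    then show ?thesis by blast
  qed
  moreover have "linear_order_on (edges H) (ord H)"
    using linear_order_on_inj_image[OF lin g] by (simp add: H_def)
  ultimately have "TAG H" using fin by (auto simp: TAG_def H_def)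
  moreover have "tag_equiv G H"
  proof (rule tag_equivI[of f _ g])
    have "\<Union>(ends G ` edges G) \<subseteq> verts G"
    proof
      fix x assume "x \<in> \<Union>(ends G ` edges G)"
      then obtain e where "e \<in> edges G" "x \<in> ends G e" by blast
      with ends[of e] show "x \<in> verts G" by auto
    qed
    then show "inj_on f (\<Union>(ends G ` edges G))" by (rule inj_on_subset[OF f])
    show "bij_betw g (edges G) (edges H)" using g by (simp add: H_def bij_betw_def)
    show "ends H (g e) = f ` ends G e" if "e \<in> edges G" for e using that g by (simp add: H_def)
    show "(g e, g e') \<in> ord H \<longleftrightarrow> (e, e') \<in> ord G" if "e \<in> edges G" "e' \<in> edges G" for e e'
    proof
      assume "(g e, g e') \<in> ord H"
      then obtain a b where "(a, b) \<in> ord G" "g e = g a" "g e' = g b" by (auto simp: H_def)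
      moreover from this have "a \<in> edges G" "b \<in> edges G" using lin by (auto simp: order_on_defs)
      ultimately show "(e, e') \<in> ord G" using that inj_onD[OF g] by metis
    qed (auto simp: H_def)
  qed
  ultimately show ?thesis by blast
qed

lemma tag_class_eq_iff:
  assumes "TAG G" "TAG H"
  shows "tag_class G = tag_class H \<longleftrightarrow> tag_equiv G H"
proof -
  define G' H' :: "(nat, nat) tagraph"
    where "G' = (SOME K. TAG K \<and> tag_equiv G K)" and "H' = (SOME K. TAG K \<and> tag_equiv H K)"
  have G': "TAG G' \<and> tag_equiv G G'" unfolding G'_def by (rule someI_ex[OF ex_nat_TAG[OF assms(1)]])
  have H': "TAG H' \<and> tag_equiv H H'" unfolding H'_def by (rule someI_ex[OF ex_nat_TAG[OF assms(2)]])
  have "tag_class G = tag_class H \<longleftrightarrow> tag_rel G' H'"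
    using Quotient3_rel[OF Quotient3_tag, of G' H'] G' H'
    by (simp add: tag_class_def G'_def[symmetric] H'_def[symmetric] tag_rel_def tag_equiv_refl)
  also have "\<dots> \<longleftrightarrow> tag_equiv G H"
    using G' H' unfolding tag_rel_def by (metis tag_equiv_sym tag_equiv_trans)
  finally show ?thesis .
qed

lemma tag_class_nat:
  assumes "TAG G"
  shows "tag_class G = abs_tag G"
proof -
  let ?H = "SOME K :: (nat, nat) tagraph. TAG K \<and> tag_equiv G K"
  have "TAG ?H \<and> tag_equiv G ?H" by (rule someI_ex[OF ex_nat_TAG[OF assms]])
  then have "tag_rel G ?H" using assms by (simp add: tag_rel_def)
  then show ?thesis unfolding tag_class_def using Quotient3_rel_abs[OF Quotient3_tag] by metis
qed

subsection \<open>Subgraphs and shrinkings of isomorphic graphs\<close>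

lemma linear_order_on_Restr:
  assumes "linear_order_on A r" "B \<subseteq> A"
  shows "linear_order_on B (Restr r B)"
proof -
  have r: "refl_on A r" "trans r" "antisym r" "total_on A r" using assms(1) by (auto simp: order_on_defs)
  have "trans (Restr r B)" using r(2) unfolding trans_def by blast
  moreover have "antisym (Restr r B)" using r(3) unfolding antisym_def by blast
  moreover have "refl_on B (Restr r B)" using r(1) assms(2) unfolding refl_on_def by blast
  moreover have "total_on B (Restr r B)" using r(4) assms(2) unfolding total_on_def by blast
  ultimately show ?thesis by (simp add: order_on_defs)
qed

lemma TAG_ends_subset: "\<lbrakk>TAG G; e \<in> edges G\<rbrakk> \<Longrightarrow> ends G e \<subseteq> verts G"
  unfolding TAG_def by (metis bot.extremum insert_subset)

lemma tag_iso_imp_tag_equiv: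
  assumes "TAG G" "tag_iso G H"
  shows "tag_equiv G H"
proof -
  obtain f g where fg: "bij_betw f (verts G) (verts H)" "bij_betw g (edges G) (edges H)"
    "\<forall>e\<in>edges G. ends H (g e) = f ` ends G e"
    "\<forall>e\<in>edges G. \<forall>e'\<in>edges G. (g e, g e') \<in> ord H \<longleftrightarrow> (e, e') \<in> ord G"
    using assms(2) unfolding tag_iso_def by blast
  have "\<Union>(ends G ` edges G) \<subseteq> verts G" using TAG_ends_subset[OF assms(1)] by fast
  then have "inj_on f (\<Union>(ends G ` edges G))"
    using fg(1) by (auto simp: bij_betw_def intro: inj_on_subset)
  then show ?thesis by (rule tag_equivI[of f _ g]) (use fg in auto)
qed

lemma TAG_subgraph:
  assumes "TAG G" "S \<subseteq> edges G"
  shows "TAG (subgraph G S)"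
proof -
  have "finite S" using assms finite_subset by (auto simp: TAG_def)
  moreover have "finite (\<Union>(ends G ` S))"
  proof (rule finite_subset)
    show "\<Union>(ends G ` S) \<subseteq> verts G" using TAG_ends_subset[OF assms(1)] assms(2) by blast
    show "finite (verts G)" using assms(1) by (simp add: TAG_def)
  qed
  moreover have "\<forall>e\<in>S. \<exists>u\<in>\<Union>(ends G ` S). \<exists>v\<in>\<Union>(ends G ` S). ends G e = {u, v}"
  proof
    fix e assume e: "e \<in> S"
    then have "\<exists>u\<in>verts G. \<exists>v\<in>verts G. ends G e = {u, v}" using assms by (auto simp: TAG_def)
    then obtain u v where "ends G e = {u, v}" by blast
    then show "\<exists>u\<in>\<Union>(ends G ` S). \<exists>v\<in>\<Union>(ends G ` S). ends G e = {u, v}"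
      using e by (intro bexI[of _ u] bexI[of _ v]) auto
  qed
  moreover have "linear_order_on S (Restr (ord G) S)"
    using assms by (intro linear_order_on_Restr[of "edges G"]) (simp_all add: TAG_def)
  ultimately show ?thesis by (simp only: TAG_def subgraph_def tagraph.simps simp_thms)
qed

lemma TAG_shrink:
  assumes "TAG G"
  shows "TAG (shrink G S)"
proof -
  have "finite (verts G // connected_by G S)"
    using assms by (auto simp: TAG_def quotient_def)
  moreover have "\<exists>C\<in>verts G // connected_by G S. \<exists>D\<in>verts G // connected_by G S.
      (\<lambda>v. connected_by G S `` {v}) ` ends G e = {C, D}" if e: "e \<in> edges G" for e
  proof -
    obtain u v where "u \<in> verts G" "v \<in> verts G" "ends G e = {u, v}"
      using assms e by (auto simp: TAG_def)
    then show ?thesis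
      by (intro bexI[of _ "connected_by G S `` {u}"] bexI[of _ "connected_by G S `` {v}"])
        (auto simp: quotient_def)
  qed
  ultimately show ?thesis
    using assms linear_order_on_Restr[of "edges G" "ord G" "edges G - S"]
    by (auto simp: TAG_def shrink_def)
qed

lemma connected_by_image:
  assumes "TAG G" "TAG H" "S \<subseteq> edges G"
    and f: "bij_betw f (\<Union>(ends G ` edges G)) (\<Union>(ends H ` edges H))"
    and g: "bij_betw g (edges G) (edges H)"
    and e: "\<And>e. e \<in> edges G \<Longrightarrow> ends H (g e) = f ` ends G e"
    and v: "v \<in> \<Union>(ends G ` edges G)"
  shows "connected_by H (g ` S) `` {f v} = f ` (connected_by G S `` {v})"
    and "connected_by G S `` {v} \<subseteq> \<Union>(ends G ` edges G)"
proof -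
  let ?C = "\<Union>(ends G ` edges G)" and ?D = "\<Union>(ends H ` edges H)"
  let ?R = "{(u, v). \<exists>e\<in>S. ends G e = {u, v}}" and ?Q = "{(u, v). \<exists>e\<in>g ` S. ends H e = {u, v}}"
  have C: "?C \<subseteq> verts G" and D: "?D \<subseteq> verts H" using TAG_ends_subset assms(1,2) by fast+
  have inC: "w \<in> ?C" if "(v, w) \<in> ?R\<^sup>*" for w
    using that by (induction rule: rtrancl_induct) (use v assms(3) in auto)
  then show "connected_by G S `` {v} \<subseteq> ?C" by (auto simp: connected_by_def)
  have 1: "(f v, f w) \<in> ?Q\<^sup>*" if "(v, w) \<in> ?R\<^sup>*" for w
    using that
  proof (induction rule: rtrancl_induct)
    case (step y z)
    then obtain d where "d \<in> S" "ends G d = {y, z}" by blast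
    then have "g d \<in> g ` S" "ends H (g d) = {f y, f z}" using assms(3) e by auto
    then have "(f y, f z) \<in> ?Q" by blast
    with step.IH show ?case by (rule rtrancl_into_rtrancl)
  qed simp
  have 2: "\<exists>u. w = f u \<and> (v, u) \<in> ?R\<^sup>*" if "(f v, w) \<in> ?Q\<^sup>*" for w
    using that
  proof (induction rule: rtrancl_induct)
    case (step y z)
    then obtain u where u: "y = f u" "(v, u) \<in> ?R\<^sup>*" by blast
    obtain d where d: "d \<in> S" "ends H (g d) = {y, z}" using step.hyps(2) by blast
    have dG: "d \<in> edges G" using d assms(3) by blast
    have "\<exists>a\<in>verts G. \<exists>b\<in>verts G. ends G d = {a, b}" using dG assms(1) by (auto simp: TAG_def)
    then obtain a b where ab: "ends G d = {a, b}" by blast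
    have in': "a \<in> ?C" "b \<in> ?C" "u \<in> ?C" using ab dG inC[OF u(2)] by auto
    have inj: "inj_on f ?C" using f by (simp add: bij_betw_def)
    have "{f a, f b} = {f u, z}" using e[OF dG] d ab u(1) by simp
    then have "f a = f u \<and> f b = z \<or> f a = z \<and> f b = f u" by (auto simp: doubleton_eq_iff)
    then have "a = u \<and> f b = z \<or> f a = z \<and> b = u" using inj in' by (auto dest: inj_onD)
    then obtain x where "z = f x" "ends G d = {u, x}" using ab by blast
    then have "z = f x" "(u, x) \<in> ?R" using d(1) by blast+
    with u(2) show ?case by (blast intro: rtrancl_into_rtrancl)
  qed blast
  have 3: "f u \<in> verts H" if "u \<in> ?C" for u using bij_betwE[OF f] that D by blast
  show "connected_by H (g ` S) `` {f v} = f ` (connected_by G S `` {v})"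
  proof (intro equalityI subsetI)
    fix w assume "w \<in> connected_by H (g ` S) `` {f v}"
    then have "(f v, w) \<in> ?Q\<^sup>*" by (auto simp: connected_by_def)
    then obtain u where "w = f u" "(v, u) \<in> ?R\<^sup>*" using 2 by blast
    then show "w \<in> f ` (connected_by G S `` {v})"
      using inC C v by (auto simp: connected_by_def)
  next
    fix w assume "w \<in> f ` (connected_by G S `` {v})"
    then obtain u where "w = f u" "(v, u) \<in> ?R\<^sup>*" by (auto simp: connected_by_def)
    then show "w \<in> connected_by H (g ` S) `` {f v}"
      using 1 3 inC v by (auto simp: connected_by_def)
  qed
qed

lemma tag_equiv_subgraph_shrink:
  assumes "TAG G" "TAG H" "tag_equiv G H"
  obtains g where "bij_betw g (edges G) (edges H)"
    and "\<And>S. S \<subseteq> edges G \<Longrightarrow> tag_equiv (subgraph G S) (subgraph H (g ` S))"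
    and "\<And>S. S \<subseteq> edges G \<Longrightarrow> tag_equiv (shrink G S) (shrink H (g ` S))"
  using assms(3)
proof (rule tag_equivE)
  fix f g
  assume f: "bij_betw f (\<Union>(ends G ` edges G)) (\<Union>(ends H ` edges H))"
    and g: "bij_betw g (edges G) (edges H)"
    and e: "\<And>e. e \<in> edges G \<Longrightarrow> ends H (g e) = f ` ends G e"
    and o: "\<And>e e'. \<lbrakk>e \<in> edges G; e' \<in> edges G\<rbrakk> \<Longrightarrow> (g e, g e') \<in> ord H \<longleftrightarrow> (e, e') \<in> ord G"
  have inj: "inj_on f (\<Union>(ends G ` edges G))" "inj_on g (edges G)" using f g by (auto simp: bij_betw_def)
  show thesis
  proof (rule that[OF g])
    fix S assume S: "S \<subseteq> edges G"
    have bS: "bij_betw g S (g ` S)" using inj(2) S by (auto simp: bij_betw_def inj_on_subset)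
    show "tag_equiv (subgraph G S) (subgraph H (g ` S))"
    proof (rule tag_equivI[of f _ g])
      show "inj_on f (\<Union>(ends (subgraph G S) ` edges (subgraph G S)))"
        using S by (auto simp: subgraph_def intro: inj_on_subset[OF inj(1)])
    qed (use bS S e o in \<open>auto simp: subgraph_def subset_iff\<close>)
    have bS': "bij_betw g (edges G - S) (edges H - g ` S)"
      using inj(2) S bij_betw_imp_surj_on[OF g] inj_on_image_set_diff[OF inj(2), of "edges G" S]
      by (simp add: bij_betw_def inj_on_subset)
    have im: "connected_by H (g ` S) `` {f v} = f ` (connected_by G S `` {v})"
        "connected_by G S `` {v} \<subseteq> \<Union>(ends G ` edges G)" if "v \<in> \<Union>(ends G ` edges G)" for v
      using connected_by_image[OF assms(1,2) S f g e that] by blast+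
    show "tag_equiv (shrink G S) (shrink H (g ` S))"
    proof (rule tag_equivI[of "image f" _ g])
      have "X \<subseteq> \<Union>(ends G ` edges G)" if "X \<in> \<Union>(ends (shrink G S) ` edges (shrink G S))" for X
        using that im(2) by (fastforce simp: shrink_def)
      then show "inj_on (image f) (\<Union>(ends (shrink G S) ` edges (shrink G S)))"
        by (intro inj_onI) (metis inj_on_image_eq_iff inj(1))
      show "ends (shrink H (g ` S)) (g d) = image f ` ends (shrink G S) d"
        if "d \<in> edges (shrink G S)" for d
      proof -
        have d: "d \<in> edges G" using that by (simp add: shrink_def)
        have "(\<lambda>v. connected_by H (g ` S) `` {f v}) ` ends G d
            = (\<lambda>v. f ` (connected_by G S `` {v})) ` ends G d"
          by (rule image_cong[OF refl im(1)]) (use d in blast)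
        then show ?thesis using e[OF d] by (simp add: shrink_def image_image)
      qed
      show "(g a, g b) \<in> ord (shrink H (g ` S)) \<longleftrightarrow> (a, b) \<in> ord (shrink G S)"
        if "a \<in> edges (shrink G S)" "b \<in> edges (shrink G S)" for a b
        using that o[of a b] bij_betwE[OF bS'] by (auto simp: shrink_def)
    qed (use bS' in \<open>simp add: shrink_def\<close>)
  qed
qed

lemma sum_subgraph_shrink_cong:
  fixes F :: "tag \<Rightarrow> tag \<Rightarrow> 'c::comm_monoid_add"
  assumes "TAG G" "TAG H" "tag_equiv G H"
  shows "(\<Sum>S\<in>Pow (edges G). F (tag_class (subgraph G S)) (tag_class (shrink G S))) =
    (\<Sum>S\<in>Pow (edges H). F (tag_class (subgraph H S)) (tag_class (shrink H S)))"
  using assms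
proof (rule tag_equiv_subgraph_shrink)
  fix g assume g: "bij_betw g (edges G) (edges H)"
    and sub: "\<And>S. S \<subseteq> edges G \<Longrightarrow> tag_equiv (subgraph G S) (subgraph H (g ` S))"
    and shr: "\<And>S. S \<subseteq> edges G \<Longrightarrow> tag_equiv (shrink G S) (shrink H (g ` S))"
  show ?thesis
  proof -
    have "(\<Sum>S\<in>Pow (edges G). F (tag_class (subgraph G S)) (tag_class (shrink G S))) =
      (\<Sum>S\<in>Pow (edges G). F (tag_class (subgraph H (g ` S))) (tag_class (shrink H (g ` S))))"
    proof (rule sum.cong[OF refl])
      fix S assume "S \<in> Pow (edges G)"
      then have S: "S \<subseteq> edges G" "g ` S \<subseteq> edges H" using g by (auto simp: bij_betw_def)
      then show "F (tag_class (subgraph G S)) (tag_class (shrink G S)) =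
          F (tag_class (subgraph H (g ` S))) (tag_class (shrink H (g ` S)))"
        using sub[OF S(1)] shr[OF S(1)]
          tag_class_eq_iff[OF TAG_subgraph[OF assms(1) S(1)] TAG_subgraph[OF assms(2) S(2)]]
          tag_class_eq_iff[OF TAG_shrink[OF assms(1)] TAG_shrink[OF assms(2)], of S "g ` S"]
        by simp
    qed
    also have "\<dots> = (\<Sum>S\<in>Pow (edges H). F (tag_class (subgraph H S)) (tag_class (shrink H S)))"
      by (rule sum.reindex_bij_betw[OF bij_betw_Pow[OF g]])
    finally show ?thesis .
  qed
qed

section \<open>Coproduct and counit\<close>

lift_definition tag_coprod :: "tag \<Rightarrow> (tag \<times> tag \<Rightarrow>\<^sub>0 'k::field)"
  is "\<lambda>G. \<Sum>S\<in>Pow (edges G).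
    basis_vec (tag_class (subgraph G S)) \<otimes> basis_vec (tag_class (shrink G S))"
  unfolding tag_rel_def by (rule sum_subgraph_shrink_cong) blast+

definition one_tag :: tag
  where "one_tag = tag_class (empty_tag :: (nat, nat) tagraph)"

definition coproduct :: "(tag \<Rightarrow>\<^sub>0 'k::field) \<Rightarrow> (tag \<times> tag \<Rightarrow>\<^sub>0 'k)"
  where "coproduct = lin_ext (\<cdot>) tag_coprod"

definition counit :: "(tag \<Rightarrow>\<^sub>0 'k::field) \<Rightarrow> 'k"
  where "counit = lin_ext (*) (\<lambda>t. if t = one_tag then 1 else 0)"

lemma coproduct_tag_class:
  fixes G :: "('v, 'e) tagraph"
  assumes "TAG G"
  shows "coproduct (basis_vec (tag_class G)) = (\<Sum>S\<in>Pow (edges G).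
    basis_vec (tag_class (subgraph G S)) \<otimes> basis_vec (tag_class (shrink G S)))"
proof -
  obtain H :: "(nat, nat) tagraph" where H: "TAG H" "tag_equiv G H" using ex_nat_TAG[OF assms] by blast
  have "tag_class G = abs_tag H" using H assms tag_class_eq_iff tag_class_nat by metis
  moreover have "tag_rel H H" using H by (simp add: tag_rel_def tag_equiv_refl)
  ultimately have "tag_coprod (tag_class G) = (\<Sum>S\<in>Pow (edges H).
      basis_vec (tag_class (subgraph H S)) \<otimes> basis_vec (tag_class (shrink H S)))"
    by (simp add: tag_coprod.abs_eq)
  also have "\<dots> = (\<Sum>S\<in>Pow (edges G).
      basis_vec (tag_class (subgraph G S)) \<otimes> basis_vec (tag_class (shrink G S)))"
    by (rule sum_subgraph_shrink_cong[OF assms H, symmetric])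
  finally show ?thesis by (simp add: coproduct_def vector_space_fscale)
qed

lemma tag_class_eq_one_tag_iff:
  assumes "TAG G"
  shows "tag_class G = one_tag \<longleftrightarrow> edges G = {}"
proof -
  have "tag_equiv G (empty_tag :: (nat, nat) tagraph) \<longleftrightarrow> edges G = {}"
  proof
    assume "tag_equiv G (empty_tag :: (nat, nat) tagraph)"
    then show "edges G = {}" by (rule tag_equivE) (auto simp: empty_tag_def bij_betw_def)
  next
    assume "edges G = {}"
    then show "tag_equiv G (empty_tag :: (nat, nat) tagraph)"
      by (intro tag_equivI[of "\<lambda>_. 0" _ "\<lambda>_. 0"]) (auto simp: empty_tag_def bij_betw_def)
  qed
  then show ?thesis
    unfolding one_tag_def using tag_class_eq_iff[OF assms TAG_empty_tag] by blast
qed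

lemma counit_tag_class:
  assumes "TAG G"
  shows "counit (basis_vec (tag_class G)) = (if edges G = {} then 1 else 0)"
  using tag_class_eq_one_tag_iff[OF assms] by (simp add: counit_def vector_space_field)

end

theory Submission
  imports Defs
begin

text \<open>
  All maps involved are linear, so the axioms need to be checked on isomorphism classes only. Both
  sides of the coassociativity law become the sum of \<open>T \<otimes> S/T \<otimes> \<Gamma>/S\<close> over all chains \<open>T \<subseteq> S\<close> of
  sets of edges of \<open>\<Gamma>\<close>: a set of edges of \<open>\<Gamma>/T\<close> is \<open>S - T\<close> for a unique \<open>S\<close> containing \<open>T\<close>, it spans
  the subgraph \<open>S/T\<close>, and shrinking it yields \<open>\<Gamma>/S\<close>.
\<close>

section \<open>Linear maps on free vector spaces\<close>

lemma linear_eq_on_basis_vec: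
  assumes "Vector_Spaces.linear (\<cdot>) s \<phi>" "Vector_Spaces.linear (\<cdot>) s \<psi>"
    and "\<And>b. \<phi> (basis_vec b) = \<psi> (basis_vec b)"
  shows "\<phi> x = \<psi> x"
  using linear_eq_lin_ext[OF assms(1), of x] linear_eq_lin_ext[OF assms(2), of x] assms(3) by simp

lemma linear_sum:
  assumes "Vector_Spaces.linear s t \<phi>"
  shows "\<phi> (\<Sum>i\<in>A. f i) = (\<Sum>i\<in>A. \<phi> (f i))"
proof -
  interpret Vector_Spaces.linear s t \<phi> by fact
  show ?thesis by (rule sum)
qed

text \<open>By definition \<open>tensor_lift\<close> reads \<open>\<beta>\<close> only at pairs of
  basis vectors and extends linearly, so its linearity and its values on the basis follow from those
  of \<open>lin_ext\<close>.\<close>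

lemma linear_tensor_lift:
  assumes "vector_space s"
  shows "Vector_Spaces.linear (\<cdot>) s (tensor_lift s \<beta>)"
  unfolding tensor_lift_def by (rule linear_lin_ext[OF assms])

lemma tensor_lift_basis_vec:
  assumes "vector_space s"
  shows "tensor_lift s \<beta> (basis_vec (a, b)) = \<beta> (basis_vec a) (basis_vec b)"
  by (simp add: tensor_lift_def assms)

lemma linear_tensor_map: "Vector_Spaces.linear (\<cdot>) (\<cdot>) (tensor_map f g)"
  unfolding tensor_map_def by (rule linear_tensor_lift[OF vector_space_fscale])

lemma tensor_map_basis_vec: "tensor_map f g (basis_vec (a, b)) = f (basis_vec a) \<otimes> g (basis_vec b)"
  by (simp add: tensor_map_def tensor_lift_basis_vec vector_space_fscale)

lemma linear_tensor_assoc: "Vector_Spaces.linear (\<cdot>) (\<cdot>) tensor_assoc"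
  unfolding tensor_assoc_def by (rule linear_tensor_lift[OF vector_space_fscale])

lemma tensor_assoc_basis_vec: "tensor_assoc (basis_vec ((a, b), c)) = basis_vec (a, b, c)"
  by (simp add: tensor_assoc_def tensor_lift_basis_vec vector_space_fscale)

section \<open>Iterated subgraphs and shrinkings\<close>

lemma edges_subgraph [simp]: "edges (subgraph G S) = S"
  by (simp add: subgraph_def)

lemma edges_shrink [simp]: "edges (shrink G S) = edges G - S"
  by (simp add: shrink_def)

section \<open>Nested subgraphs, trivial shrinking, and shrinking inside a subgraph\<close>

lemma subgraph_subgraph:
  assumes "T \<subseteq> S"
  shows "subgraph (subgraph G S) T = subgraph G T"
  using assms by (auto simp: subgraph_def)

text \<open>\<open>tag_equiv\<close> sees only the edges, their endpoints and their order, and these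
  are unchanged when isolated vertices are dropped. This identifies the surviving term of the right
  counit law.\<close>

lemma tag_equiv_subgraph_edges: "tag_equiv (subgraph G (edges G)) G"
  by (rule tag_equivI[of id _ id]) (auto simp: subgraph_def)

lemma TAG_ends_doubleton:
  assumes "TAG G" "e \<in> edges G"
  obtains a b where "a \<in> verts G" "b \<in> verts G" "ends G e = {a, b}"
  using assms unfolding TAG_def by blast

text \<open>Without edges every vertex is its own component, so \<open>v\<close> corresponds to the
  class \<open>{v}\<close>. This identifies the surviving term of the left counit law.\<close>

lemma tag_equiv_shrink_empty:
  assumes "TAG G"
  shows "tag_equiv G (shrink G {})"
proof (rule tag_equivI[of "\<lambda>v. {v}" _ id])
  fix e assume e: "e \<in> edges G"
  have "connected_by G {} `` {v} = {v}" if "v \<in> ends G e" for v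
    using TAG_ends_subset[OF assms e] that by (auto simp: connected_by_def)
  then show "ends (shrink G {}) (id e) = (\<lambda>v. {v}) ` ends G e"
    by (auto simp: shrink_def)
qed (auto simp: shrink_def)

text \<open>A path with edges in \<open>T \<subseteq> S\<close> that starts at a vertex of the
  \<open>S\<close>-subgraph never leaves it, so restricting to the smaller vertex set cuts nothing
  off. For \<open>v\<close> outside the subgraph the left class would be empty.\<close>

lemma connected_by_subgraph:
  assumes "TAG G" "S \<subseteq> edges G" "T \<subseteq> S" "v \<in> \<Union>(ends G ` S)"
  shows "connected_by (subgraph G S) T `` {v} = connected_by G T `` {v}"
proof -
  let ?R = "{(u, v). \<exists>e\<in>T. ends G e = {u, v}}"
  have sub: "\<Union>(ends G ` S) \<subseteq> verts G" using TAG_ends_subset[OF assms(1)] assms(2) by blast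
  have "w \<in> \<Union>(ends G ` S)" if "(v, w) \<in> ?R\<^sup>*" for w
    using that by (induction rule: rtrancl_induct) (use assms(3,4) in auto)
  then show ?thesis using sub assms(4) by (auto simp: connected_by_def subgraph_def)
qed

text \<open>Both graphs have the edges \<open>S - T\<close>, and the endpoints are the same
  \<open>T\<close>-classes, so identity maps suffice. The two need not be equal: only the left one
  keeps contracted components that no edge of \<open>S - T\<close> meets.\<close>

lemma tag_equiv_shrink_subgraph:
  assumes "TAG G" "S \<subseteq> edges G" "T \<subseteq> S"
  shows "tag_equiv (shrink (subgraph G S) T) (subgraph (shrink G T) (S - T))"
proof (rule tag_equivI[of id _ id])
  fix e assume "e \<in> edges (shrink (subgraph G S) T)"
  then have "e \<in> S" by simp
  then have "connected_by (subgraph G S) T `` {v} = connected_by G T `` {v}" if "v \<in> ends G e" for v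
    using connected_by_subgraph[OF assms] that by blast
  then show "ends (subgraph (shrink G T) (S - T)) (id e) = id ` ends (shrink (subgraph G S) T) e"
    by (auto simp: subgraph_def shrink_def)
qed (use assms in \<open>auto simp: subgraph_def shrink_def\<close>)

section \<open>Shrinking in two stages\<close>

lemma equiv_connected_by: "equiv (verts G) (connected_by G S)"
proof -
  \<comment> \<open>Endpoints form an unordered pair, so adjacency is symmetric, and so is its
    closure.\<close>
  have "sym {(u, v). \<exists>e\<in>S. ends G e = {u, v}}" by (auto simp: sym_def insert_commute)
  then have "sym ({(u, v). \<exists>e\<in>S. ends G e = {u, v}}\<^sup>*)" by (rule sym_rtrancl)
  then show ?thesis
    by (auto simp: equiv_def connected_by_def refl_on_def sym_def trans_def)
qed

lemma connected_by_mono: "T \<subseteq> S \<Longrightarrow> connected_by G T \<subseteq> connected_by G S"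
  unfolding connected_by_def by (intro Int_mono rtrancl_mono subset_refl) blast

lemma connected_by_edge:
  "\<lbrakk>e \<in> S; ends G e = {a, b}; a \<in> verts G; b \<in> verts G\<rbrakk> \<Longrightarrow> (a, b) \<in> connected_by G S"
  unfolding connected_by_def by blast

text \<open>Paths are moved between \<open>G\<close> and its shrinking. Projecting an
  \<open>S\<close>-path to \<open>T\<close>-classes turns its \<open>T\<close>-edges into constant
  steps and leaves a path in \<open>S - T\<close>. Conversely, a path in the shrinking lifts to
  \<open>G\<close> once the gaps inside each \<open>T\<close>-class are bridged.\<close>

lemma connected_by_shrink:
  assumes "TAG G" "S \<subseteq> edges G" "T \<subseteq> S" "v \<in> verts G"
  shows "connected_by (shrink G T) (S - T) `` {connected_by G T `` {v}} =
    (\<lambda>w. connected_by G T `` {w}) ` (connected_by G S `` {v})"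
proof -
  let ?c = "\<lambda>w. connected_by G T `` {w}"
  let ?R = "{(u, v). \<exists>e\<in>S. ends G e = {u, v}}"
  let ?Q = "{(X, Y). \<exists>e\<in>S - T. ends (shrink G T) e = {X, Y}}"
  note ET = equiv_connected_by[of G T] and ES = equiv_connected_by[of G S]
  have cV: "?c w \<in> verts (shrink G T)" if "w \<in> verts G" for w
    using that by (auto simp: shrink_def quotient_def)
  have 1: "w \<in> verts G \<and> (?c v, ?c w) \<in> ?Q\<^sup>*" if "(v, w) \<in> ?R\<^sup>*" for w
    using that
  proof (induction rule: rtrancl_induct)
    case (step y z)
    then obtain e where e: "e \<in> S" "ends G e = {y, z}" by blast
    have "ends G e \<subseteq> verts G" using TAG_ends_subset[OF assms(1)] e(1) assms(2) by blast
    then have V: "y \<in> verts G" "z \<in> verts G" using e(2) by auto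
    have "(?c y, ?c z) \<in> ?Q\<^sup>*"
    proof (cases "e \<in> T")
      case True
      \<comment> \<open>An edge of \<open>T\<close> joins two vertices of the same class, so the
        projected path stands still.\<close>
      then have "?c y = ?c z" using equiv_class_eq[OF ET connected_by_edge[OF _ e(2) V]] by simp
      then show ?thesis by simp
    next
      case False
      then have "e \<in> S - T" "ends (shrink G T) e = {?c y, ?c z}"
        using e by (auto simp: shrink_def)
      then show ?thesis by blast
    qed
    with step.IH V(2) show ?case by (auto intro: rtrancl_trans)
  qed (use assms(4) in simp)
  have 2: "\<exists>w. X = ?c w \<and> (v, w) \<in> connected_by G S" if "(?c v, X) \<in> ?Q\<^sup>*" for X
    using that
  proof (induction rule: rtrancl_induct)
    case base
    then show ?case using equiv_class_self[OF ES assms(4)] by blast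
  next
    case (step Y Z)
    then obtain y where y: "Y = ?c y" "(v, y) \<in> connected_by G S" by blast
    obtain e where e: "e \<in> S - T" "ends (shrink G T) e = {Y, Z}" using step.hyps(2) by blast
    then have eG: "e \<in> edges G" using assms(2) by blast
    obtain a b where ab: "a \<in> verts G" "b \<in> verts G" "ends G e = {a, b}"
      by (rule TAG_ends_doubleton[OF assms(1) eG])
    have "{?c a, ?c b} = {Y, Z}" using e(2) ab(3) by (simp add: shrink_def)
    \<comment> \<open>An equality of unordered pairs may swap the ends; \<open>p\<close> and
      \<open>q\<close> name the ends of \<open>e\<close> lying over \<open>Y\<close> and
      \<open>Z\<close>.\<close>
    then obtain p q where pq: "p \<in> verts G" "q \<in> verts G" "ends G e = {p, q}" "Y = ?c p" "Z = ?c q"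
      using ab by (metis doubleton_eq_iff)
    \<comment> \<open>The lifted path ends at \<open>y\<close>, while the next edge starts at a
      possibly different representative \<open>p\<close> of \<open>Y\<close>. The two are joined
      inside \<open>T\<close>, hence inside \<open>S\<close>.\<close>
    have "(y, p) \<in> connected_by G T"
      using equiv_class_self[OF ET pq(1)] pq(4) y(1) by blast
    then have "(y, p) \<in> connected_by G S" using connected_by_mono[OF assms(3)] by blast
    moreover have "(p, q) \<in> connected_by G S" using connected_by_edge[OF _ pq(3,1,2)] e(1) by blast
    ultimately have "(v, q) \<in> connected_by G S"
      using y(2) ES by (meson equivE transD)
    then show ?case using pq(5) by blast
  qed
  show ?thesis
  proof (intro equalityI subsetI)
    fix X assume "X \<in> connected_by (shrink G T) (S - T) `` {?c v}"
    then have "(?c v, X) \<in> ?Q\<^sup>*" by (auto simp: connected_by_def)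
    then show "X \<in> ?c ` (connected_by G S `` {v})" using 2 by blast
  next
    fix X assume "X \<in> ?c ` (connected_by G S `` {v})"
    then obtain w where w: "X = ?c w" "(v, w) \<in> ?R\<^sup>*" by (auto simp: connected_by_def)
    then show "X \<in> connected_by (shrink G T) (S - T) `` {?c v}"
      using 1[OF w(2)] cV assms(4) unfolding connected_by_def[of "shrink G T"] by blast
  qed
qed

text \<open>A vertex of the double shrinking is a set of \<open>T\<close>-classes, one of the single
  shrinking a set of vertices. Since \<open>T\<close>-classes refine \<open>S\<close>-classes,
  \<open>Union\<close> flattens the former to the latter.\<close>

lemma tag_equiv_shrink_shrink:
  assumes "TAG G" "S \<subseteq> edges G" "T \<subseteq> S"
  shows "tag_equiv (shrink (shrink G T) (S - T)) (shrink G S)"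
proof -
  let ?K = "shrink (shrink G T) (S - T)"
  let ?c = "\<lambda>w. connected_by G T `` {w}"
  have E: "edges ?K = edges G - S" using assms(3) by auto
  have ends: "ends ?K e = (\<lambda>v. ?c ` (connected_by G S `` {v})) ` ends G e" if "e \<in> edges G" for e
  proof -
    have "ends ?K e = (\<lambda>v. connected_by (shrink G T) (S - T) `` {?c v}) ` ends G e"
      by (simp add: shrink_def image_image)
    also have "\<dots> = (\<lambda>v. ?c ` (connected_by G S `` {v})) ` ends G e"
      by (rule image_cong[OF refl connected_by_shrink[OF assms]])
        (use TAG_ends_subset[OF assms(1) that] in blast)
    finally show ?thesis .
  qed
  have Un: "\<Union>(?c ` (connected_by G S `` {v})) = connected_by G S `` {v}" for v
  proof (intro equalityI subsetI)
    fix x assume "x \<in> \<Union>(?c ` (connected_by G S `` {v}))"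
    then obtain w where "(v, w) \<in> connected_by G S" "(w, x) \<in> connected_by G T" by blast
    then show "x \<in> connected_by G S `` {v}"
      using connected_by_mono[OF assms(3)] equiv_connected_by[of G S]
      by (metis Image_singleton_iff equivE subsetD transD)
  next
    fix x assume x: "x \<in> connected_by G S `` {v}"
    then have "x \<in> verts G" by (auto simp: connected_by_def)
    then have "x \<in> ?c x" by (rule equiv_class_self[OF equiv_connected_by])
    with x show "x \<in> \<Union>(?c ` (connected_by G S `` {v}))" by blast
  qed
  show ?thesis
  proof (rule tag_equivI[of Union _ id])
    \<comment> \<open>Such an \<open>X\<close> is recovered from its union, being the image of that
      union under \<open>?c\<close>; hence \<open>Union\<close> is injective here.\<close>
    have "\<exists>v. X = ?c ` (connected_by G S `` {v})" if "X \<in> \<Union>(ends ?K ` edges ?K)" for X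
      using that ends E by auto
    then show "inj_on Union (\<Union>(ends ?K ` edges ?K))"
      by (intro inj_onI) (metis Un)
    show "ends (shrink G S) (id e) = Union ` ends ?K e" if "e \<in> edges ?K" for e
    proof -
      have "e \<in> edges G" using that E by blast
      then have "Union ` ends ?K e = (\<lambda>v. connected_by G S `` {v}) ` ends G e"
        by (simp only: ends image_image Un)
      then show ?thesis by (simp add: shrink_def)
    qed
    show "bij_betw id (edges ?K) (edges (shrink G S))" unfolding E by simp
    show "(id e, id e') \<in> ord (shrink G S) \<longleftrightarrow> (e, e') \<in> ord ?K"
      if "e \<in> edges ?K" "e' \<in> edges ?K" for e e'
      using that assms(3) by (auto simp: shrink_def)
  qed
qed

section \<open>Iterated operations on isomorphism classes\<close>

lemma tag_class_shrink_subgraph: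
  assumes "TAG G" "S \<subseteq> edges G" "T \<subseteq> S"
  shows "tag_class (shrink (subgraph G S) T) = tag_class (subgraph (shrink G T) (S - T))"
proof -
  have "TAG (subgraph (shrink G T) (S - T))"
    by (rule TAG_subgraph[OF TAG_shrink[OF assms(1)]]) (use assms(2) in auto)
  then show ?thesis
    using tag_class_eq_iff[OF TAG_shrink[OF TAG_subgraph[OF assms(1,2)]]]
      tag_equiv_shrink_subgraph[OF assms] by blast
qed

lemma tag_class_shrink_shrink:
  assumes "TAG G" "S \<subseteq> edges G" "T \<subseteq> S"
  shows "tag_class (shrink (shrink G T) (S - T)) = tag_class (shrink G S)"
  using tag_class_eq_iff[OF TAG_shrink[OF TAG_shrink[OF assms(1)]] TAG_shrink[OF assms(1)]]
    tag_equiv_shrink_shrink[OF assms] by blast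

section \<open>The coalgebra axioms on basis vectors\<close>

text \<open>The quotient is partial, so every element of \<open>tag\<close> is represented by a
  graph satisfying \<open>TAG\<close>; on graphs over \<open>nat\<close>, \<open>tag_class\<close>
  agrees with \<open>abs_tag\<close>.\<close>

lemma tag_cases:
  obtains G :: "(nat, nat) tagraph" where "TAG G" "t = tag_class G"
proof -
  have "\<exists>G :: (nat, nat) tagraph. TAG G \<and> t = tag_class G"
    by (induction t rule: tag.abs_induct) (metis tag_class_nat tag_rel_def)
  then show thesis using that by blast
qed

lemma linear_coproduct:
  "Vector_Spaces.linear (\<cdot>) (\<cdot>) (coproduct :: (tag \<Rightarrow>\<^sub>0 'k::field) \<Rightarrow> (tag \<times> tag \<Rightarrow>\<^sub>0 'k))"
  unfolding coproduct_def by (rule linear_lin_ext[OF vector_space_fscale])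

lemma linear_counit: "Vector_Spaces.linear (\<cdot>) (*) (counit :: (tag \<Rightarrow>\<^sub>0 'k::field) \<Rightarrow> 'k)"
  unfolding counit_def by (rule linear_lin_ext[OF vector_space_field])

section \<open>Coassociativity\<close>

lemma sum_chains:
  fixes F :: "'a set \<Rightarrow> 'a set \<Rightarrow> 'c::comm_monoid_add"
  assumes "finite E"
  shows "(\<Sum>S\<in>Pow E. \<Sum>T\<in>Pow S. F T S) = (\<Sum>T\<in>Pow E. \<Sum>U\<in>Pow (E - T). F T (T \<union> U))"
proof -
  have "(\<Sum>S\<in>Pow E. \<Sum>T\<in>Pow S. F T S) = (\<Sum>(S, T)\<in>Sigma (Pow E) Pow. F T S)"
    by (rule sum.Sigma) (use assms finite_subset in auto)
  \<comment> \<open>A chain \<open>T \<subseteq> S\<close> is the same as a pair of disjoint sets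
    \<open>T\<close> and \<open>U = S - T\<close>.\<close>
  also have "\<dots> = (\<Sum>(T, U)\<in>(SIGMA T:Pow E. Pow (E - T)). F T (T \<union> U))"
    by (rule sum.reindex_bij_witness[of _ "\<lambda>(T, U). (T \<union> U, T)" "\<lambda>(S, T). (T, S - T)"])
      (auto simp: Un_absorb1)
  also have "\<dots> = (\<Sum>T\<in>Pow E. \<Sum>U\<in>Pow (E - T). F T (T \<union> U))"
    by (rule sum.Sigma[symmetric]) (use assms in auto)
  finally show ?thesis .
qed

lemma coproduct_coassoc_tag_class:
  fixes G :: "('v, 'e) tagraph"
  assumes "TAG G"
  shows "tensor_assoc (tensor_map coproduct id (coproduct (basis_vec (tag_class G)))) =
    (tensor_map id coproduct (coproduct (basis_vec (tag_class G))) ::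
      tag \<times> tag \<times> tag \<Rightarrow>\<^sub>0 'k::field)"
proof -
  \<comment> \<open>The common summand of both sides for the chain \<open>T \<subseteq> S\<close>.
    Its middle factor has the form arising on the right; on the left it first appears as
    \<open>shrink (subgraph G S) T\<close>.\<close>
  define F :: "'e set \<Rightarrow> 'e set \<Rightarrow> (tag \<times> tag \<times> tag \<Rightarrow>\<^sub>0 'k)" where
    "F T S = basis_vec (tag_class (subgraph G T),
      tag_class (subgraph (shrink G T) (S - T)), tag_class (shrink G S))" for T S
  have fin: "finite (edges G)" using assms by (simp add: TAG_def)
  have l: "tensor_assoc (tensor_map coproduct id (basis_vec (tag_class (subgraph G S), tag_class (shrink G S))))
      = (\<Sum>T\<in>Pow S. F T S)" if S: "S \<in> Pow (edges G)" for S
  proof -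
    from S have S': "S \<subseteq> edges G" by simp
    have "tensor_assoc (tensor_map coproduct id
        (basis_vec (tag_class (subgraph G S), tag_class (shrink G S)))) =
        (\<Sum>T\<in>Pow S. basis_vec (tag_class (subgraph (subgraph G S) T),
          tag_class (shrink (subgraph G S) T), tag_class (shrink G S)) :: tag \<times> tag \<times> tag \<Rightarrow>\<^sub>0 'k)"
      by (simp add: tensor_map_basis_vec coproduct_tag_class[OF TAG_subgraph[OF assms S']]
          linear_sum[OF linear_tensor_left] linear_sum[OF linear_tensor_assoc]
          tensor_assoc_basis_vec)
    also have "\<dots> = (\<Sum>T\<in>Pow S. F T S)"
      by (rule sum.cong[OF refl])
        (simp add: F_def subgraph_subgraph tag_class_shrink_subgraph[OF assms S'])
    finally show ?thesis .
  qed
  have r: "tensor_map id coproduct (basis_vec (tag_class (subgraph G T), tag_class (shrink G T)))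
      = (\<Sum>U\<in>Pow (edges G - T). F T (T \<union> U))" if T: "T \<in> Pow (edges G)" for T
  proof -
    \<comment> \<open>\<open>U\<close> is disjoint from \<open>T\<close>, so it equals
      \<open>S - T\<close> for \<open>S = T \<union> U\<close>, the form required for two-stage
      shrinking.\<close>
    have "tag_class (shrink (shrink G T) U) = tag_class (shrink G (T \<union> U)) \<and> T \<union> U - T = U"
      if "U \<in> Pow (edges G - T)" for U
    proof -
      have U: "T \<union> U - T = U" using that by blast
      then show ?thesis using tag_class_shrink_shrink[OF assms, of "T \<union> U" T] that T by auto
    qed
    then have "(\<Sum>U\<in>Pow (edges G - T). basis_vec (tag_class (subgraph G T),
        tag_class (subgraph (shrink G T) U), tag_class (shrink (shrink G T) U))) =
        (\<Sum>U\<in>Pow (edges G - T). F T (T \<union> U))"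
      by (intro sum.cong[OF refl]) (simp add: F_def)
    then show ?thesis
      by (simp add: tensor_map_basis_vec coproduct_tag_class[OF TAG_shrink[OF assms]]
          linear_sum[OF linear_tensor_right])
  qed
  have "tensor_assoc (tensor_map coproduct id (coproduct (basis_vec (tag_class G)))) =
      (\<Sum>S\<in>Pow (edges G). tensor_assoc (tensor_map coproduct id
        (basis_vec (tag_class (subgraph G S), tag_class (shrink G S)))))"
    by (simp add: coproduct_tag_class[OF assms] linear_sum[OF linear_tensor_map]
        linear_sum[OF linear_tensor_assoc])
  also have "\<dots> = (\<Sum>S\<in>Pow (edges G). \<Sum>T\<in>Pow S. F T S)"
    by (rule sum.cong[OF refl l])
  also have "\<dots> = (\<Sum>T\<in>Pow (edges G). \<Sum>U\<in>Pow (edges G - T). F T (T \<union> U))"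
    by (rule sum_chains[OF fin])
  also have "\<dots> = (\<Sum>T\<in>Pow (edges G). tensor_map id coproduct
      (basis_vec (tag_class (subgraph G T), tag_class (shrink G T))))"
    by (rule sum.cong[OF refl r[symmetric]])
  also have "\<dots> = tensor_map id coproduct (coproduct (basis_vec (tag_class G)))"
    by (simp add: coproduct_tag_class[OF assms] linear_sum[OF linear_tensor_map])
  finally show ?thesis .
qed

section \<open>The counit laws\<close>

lemma counit_left_tag_class:
  fixes G :: "('v, 'e) tagraph"
  assumes "TAG G"
  shows "tensor_lift (\<cdot>) (\<lambda>x y. counit x \<cdot> y) (coproduct (basis_vec (tag_class G))) =
    (basis_vec (tag_class G) :: tag \<Rightarrow>\<^sub>0 'k::field)"
proof -
  interpret vector_space "(\<cdot>) :: 'k \<Rightarrow> (tag \<Rightarrow>\<^sub>0 'k) \<Rightarrow> _" by (rule vector_space_fscale)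
  have fin: "finite (edges G)" using assms by (simp add: TAG_def)
  have "tensor_lift (\<cdot>) (\<lambda>x y. counit x \<cdot> y) (coproduct (basis_vec (tag_class G))) =
      (\<Sum>S\<in>Pow (edges G). counit (basis_vec (tag_class (subgraph G S))) \<cdot>
        (basis_vec (tag_class (shrink G S)) :: tag \<Rightarrow>\<^sub>0 'k))"
    by (simp add: coproduct_tag_class[OF assms] linear_sum[OF linear_tensor_lift[OF vector_space_fscale]]
        tensor_lift_basis_vec vector_space_fscale)
  \<comment> \<open>The counit vanishes on graphs with edges, and the subgraph on \<open>S\<close>
    has edge set \<open>S\<close>.\<close>
  also have "\<dots> = (\<Sum>S\<in>Pow (edges G). if S = {} then basis_vec (tag_class (shrink G S)) else 0)"
    by (rule sum.cong[OF refl]) (simp add: counit_tag_class[OF TAG_subgraph[OF assms]])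
  also have "\<dots> = basis_vec (tag_class (shrink G {}))" using fin by simp
  also have "tag_class (shrink G {}) = tag_class G"
    using tag_class_eq_iff[OF assms TAG_shrink[OF assms]] tag_equiv_shrink_empty[OF assms] by metis
  finally show ?thesis .
qed

lemma counit_right_tag_class:
  fixes G :: "('v, 'e) tagraph"
  assumes "TAG G"
  shows "tensor_lift (\<cdot>) (\<lambda>x y. counit y \<cdot> x) (coproduct (basis_vec (tag_class G))) =
    (basis_vec (tag_class G) :: tag \<Rightarrow>\<^sub>0 'k::field)"
proof -
  interpret vector_space "(\<cdot>) :: 'k \<Rightarrow> (tag \<Rightarrow>\<^sub>0 'k) \<Rightarrow> _" by (rule vector_space_fscale)
  have fin: "finite (edges G)" using assms by (simp add: TAG_def)
  have "tensor_lift (\<cdot>) (\<lambda>x y. counit y \<cdot> x) (coproduct (basis_vec (tag_class G))) =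
      (\<Sum>S\<in>Pow (edges G). counit (basis_vec (tag_class (shrink G S))) \<cdot>
        (basis_vec (tag_class (subgraph G S)) :: tag \<Rightarrow>\<^sub>0 'k))"
    by (simp add: coproduct_tag_class[OF assms] linear_sum[OF linear_tensor_lift[OF vector_space_fscale]]
        tensor_lift_basis_vec vector_space_fscale)
  \<comment> \<open>The shrinking has edge set \<open>edges G - S\<close>, empty for
    \<open>S \<subseteq> edges G\<close> only if \<open>S = edges G\<close>; its remaining isolated
    points do not distinguish it from the empty graph.\<close>
  also have "\<dots> = (\<Sum>S\<in>Pow (edges G). if S = edges G then basis_vec (tag_class (subgraph G S)) else 0)"
    by (rule sum.cong[OF refl]) (auto simp: counit_tag_class[OF TAG_shrink[OF assms]])
  also have "\<dots> = basis_vec (tag_class (subgraph G (edges G)))" using fin by simp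
  also have "tag_class (subgraph G (edges G)) = tag_class G"
    using tag_class_eq_iff[OF TAG_subgraph[OF assms subset_refl] assms] tag_equiv_subgraph_edges
    by blast
  finally show ?thesis .
qed

theorem mainTheorem4:
  shows "coalgebra (coproduct :: (tag \<Rightarrow>\<^sub>0 'k::field_char_0) \<Rightarrow> (tag \<times> tag \<Rightarrow>\<^sub>0 'k))
    (counit :: (tag \<Rightarrow>\<^sub>0 'k) \<Rightarrow> 'k)"
proof (rule coalgebra.intro)
  let ?\<Delta> = "coproduct :: (tag \<Rightarrow>\<^sub>0 'k) \<Rightarrow> (tag \<times> tag \<Rightarrow>\<^sub>0 'k)"
  let ?\<epsilon> = "counit :: (tag \<Rightarrow>\<^sub>0 'k) \<Rightarrow> 'k"
  \<comment> \<open>Composition is unfolded so that the composites unify with the nested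
    applications in the axioms.\<close>
  note comp = Vector_Spaces.linear_compose[unfolded o_def]
  note lift = linear_tensor_lift[OF vector_space_fscale]
  \<comment> \<open>The right-hand sides of the counit laws are the identity map, which must be
    known to be linear before values on basis vectors can be compared.\<close>
  have id: "Vector_Spaces.linear (\<cdot>) (\<cdot>) (\<lambda>x :: tag \<Rightarrow>\<^sub>0 'k. x)"
    by (rule vector_space.linear_ident[OF vector_space_fscale])
  show "Vector_Spaces.linear (\<cdot>) (\<cdot>) ?\<Delta>" by (rule linear_coproduct)
  show "Vector_Spaces.linear (\<cdot>) (*) ?\<epsilon>" by (rule linear_counit)
  show "tensor_assoc (tensor_map ?\<Delta> id (?\<Delta> x)) = tensor_map id ?\<Delta> (?\<Delta> x)" for x
  proof (rule linear_eq_on_basis_vec[OF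
        comp[OF comp[OF linear_coproduct linear_tensor_map] linear_tensor_assoc]
        comp[OF linear_coproduct linear_tensor_map]])
    show "tensor_assoc (tensor_map ?\<Delta> id (?\<Delta> (basis_vec t))) =
        tensor_map id ?\<Delta> (?\<Delta> (basis_vec t))" for t
      by (cases t rule: tag_cases) (simp add: coproduct_coassoc_tag_class)
  qed
  show "tensor_lift (\<cdot>) (\<lambda>x y. ?\<epsilon> x \<cdot> y) (?\<Delta> x) = x" for x
  proof (rule linear_eq_on_basis_vec[OF comp[OF linear_coproduct lift] id])
    show "tensor_lift (\<cdot>) (\<lambda>x y. ?\<epsilon> x \<cdot> y) (?\<Delta> (basis_vec t)) = basis_vec t" for t
      by (cases t rule: tag_cases) (simp add: counit_left_tag_class)
  qed
  show "tensor_lift (\<cdot>) (\<lambda>x y. ?\<epsilon> y \<cdot> x) (?\<Delta> x) = x" for x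
  proof (rule linear_eq_on_basis_vec[OF comp[OF linear_coproduct lift] id])
    show "tensor_lift (\<cdot>) (\<lambda>x y. ?\<epsilon> y \<cdot> x) (?\<Delta> (basis_vec t)) = basis_vec t" for t
      by (cases t rule: tag_cases) (simp add: counit_right_tag_class)
  qed
qed

end
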